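(* Let $(\Gamma,N)$ and $(\Gamma',N')$ be equivalent link-regular numbered graphs. Then $\mathrm{NGP}(\Gamma,N)$ and $\mathrm{NGP}(\Gamma',N')$, each with respect to its standard generating set, have the same geodesic growth series.
   Context: A numbered graph $(\Gamma,N)$ is a finite simplicial graph $\Gamma$ (vertex set $V\Gamma$, edge set $E\Gamma$) together with a map $N: V\Gamma\to\{2,3,4,\dots\}$. The numbered graph product $\mathrm{NGP}(\Gamma,N)$ is the group with presentation $\langle v\in V\Gamma \mid v^{N(v)}=1 \text{ for all } v,\ uv=vu \text{ for all } \{u,v\}\in E\Gamma\rangle$. Its standard generating set is $S=V\Gamma\cup(V\Gamma)^{-1}$ (when $N(v)=2$, $v^{-1}=v$ is a single element of $S$). A word over $S$ is a geodesic if no shorter word over $S$ represents the same group element; the geodesic growth series is $\sum_{n\ge0} a_n z^n$ where $a_n$ is the number of geodesic words of length $n$. A clique is a subset $\sigma\subseteq V\Gamma$ spanning a complete subgraph (the empty set is a clique); its link is $\mathrm{Lk}(\sigma)=\{v\in V\Gamma\setminus\sigma \mid \sigma\cup\{v\}\text{ is a clique}\}$. For $U\subseteq V\Gamma$, $N(U)$ denotes the multiset $\{N(v)\mid v\in U\}$. $(\Gamma,N)$ is link-regular if for all cliques $\sigma_1,\sigma_2$ of $\Gamma$ with $N(\sigma_1)=N(\sigma_2)$ one has $N(\mathrm{Lk}(\sigma_1))=N(\mathrm{Lk}(\sigma_2))$. Two link-regular numbered graphs $(\Gamma,N)$, $(\Gamma',N')$ are equivalent if (i) $N(V\Gamma)=N'(V\Gamma')$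 as multisets, and (ii) whenever cliques $\sigma\subseteq V\Gamma$, $\sigma'\subseteq V\Gamma'$ satisfy $N(\sigma)=N'(\sigma')$, one has $N(\mathrm{Lk}(\sigma))=N'(\mathrm{Lk}(\sigma'))$. *)

theory Defs
  imports "HOL-Algebra.Group" "HOL-Library.Multiset"
    "HOL-Computational_Algebra.Formal_Power_Series"
begin

section \<open>Groups given by generators and relations\<close>

text \<open>
  A letter \<open>(x, True)\<close> stands for the generator \<open>x\<close>, and \<open>(x, False)\<close> for its formal inverse.
  The elements of the presented group are the classes of words in these letters modulo the least
  congruence containing the free cancellations and the given relations \<open>l = r\<close>.
\<close>

type_synonym 'a gword = "('a \<times> bool) list"

definition gwords :: "'a set \<Rightarrow> 'a gword set" where
  "gwords X = lists (X \<times> UNIV)"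

inductive_set pres_rel :: "'a set \<Rightarrow> ('a gword \<times> 'a gword) set \<Rightarrow> ('a gword \<times> 'a gword) set"
  for X :: "'a set" and R :: "('a gword \<times> 'a gword) set" where
  refl: "w \<in> gwords X \<Longrightarrow> (w, w) \<in> pres_rel X R"
| sym: "(u, v) \<in> pres_rel X R \<Longrightarrow> (v, u) \<in> pres_rel X R"
| trans: "(u, v) \<in> pres_rel X R \<Longrightarrow> (v, w) \<in> pres_rel X R \<Longrightarrow> (u, w) \<in> pres_rel X R"
| append: "(u, u') \<in> pres_rel X R \<Longrightarrow> (v, v') \<in> pres_rel X R \<Longrightarrow> (u @ v, u' @ v') \<in> pres_rel X R"
| cancel: "x \<in> X \<Longrightarrow> ([(x, b), (x, \<not> b)], []) \<in> pres_rel X R"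
| relation: "(l, r) \<in> R \<Longrightarrow> l \<in> gwords X \<Longrightarrow> r \<in> gwords X \<Longrightarrow> (l, r) \<in> pres_rel X R"

definition pres_class :: "'a set \<Rightarrow> ('a gword \<times> 'a gword) set \<Rightarrow> 'a gword \<Rightarrow> 'a gword set" where
  "pres_class X R w = pres_rel X R `` {w}"

definition presented_group ::
    "'a set \<Rightarrow> ('a gword \<times> 'a gword) set \<Rightarrow> 'a gword set monoid" where
  "presented_group X R =
    \<lparr>carrier = gwords X // pres_rel X R,
     monoid.mult = (\<lambda>A B. \<Union>u\<in>A. \<Union>v\<in>B. pres_class X R (u @ v)),
     one = pres_class X R []\<rparr>"

lemma pres_rel_gwords: "(u, v) \<in> pres_rel X R \<Longrightarrow> u \<in> gwords X \<and> v \<in> gwords X"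
  by (induction rule: pres_rel.induct) (auto simp: gwords_def)

lemma equiv_pres_rel: "equiv (gwords X) (pres_rel X R)"
proof (rule equivI)
  show "pres_rel X R \<subseteq> gwords X \<times> gwords X" using pres_rel_gwords by fast
  show "refl_on (gwords X) (pres_rel X R)" by (rule refl_onI) (rule pres_rel.refl)
  show "sym_on UNIV (pres_rel X R)" by (rule symI) (rule pres_rel.sym)
  show "trans_on UNIV (pres_rel X R)" by (rule transI) (rule pres_rel.trans)
qed

lemma pres_class_eq_iff:
  "u \<in> gwords X \<Longrightarrow> v \<in> gwords X \<Longrightarrow>
    pres_class X R u = pres_class X R v \<longleftrightarrow> (u, v) \<in> pres_rel X R"
  unfolding pres_class_def using eq_equiv_class_iff[OF equiv_pres_rel] .

lemma carrier_presented_group: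
  "carrier (presented_group X R) = pres_class X R ` gwords X"
  by (auto simp: presented_group_def quotient_def pres_class_def)

lemma one_presented_group: "\<one>\<^bsub>presented_group X R\<^esub> = pres_class X R []"
  by (simp add: presented_group_def)

lemma mult_presented_group:
  assumes "u \<in> gwords X" "v \<in> gwords X"
  shows "pres_class X R u \<otimes>\<^bsub>presented_group X R\<^esub> pres_class X R v = pres_class X R (u @ v)"
proof -
  have self: "u \<in> pres_class X R u" "v \<in> pres_class X R v"
    using assms by (simp_all add: pres_class_def pres_rel.refl)
  have "pres_class X R (u' @ v') = pres_class X R (u @ v)"
    if "u' \<in> pres_class X R u" "v' \<in> pres_class X R v" for u' v'
  proof -
    have r: "(u @ v, u' @ v') \<in> pres_rel X R"
      using that by (intro pres_rel.append) (simp_all add: pres_class_def)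
    show ?thesis
      unfolding pres_class_def using equiv_class_eq[OF equiv_pres_rel r] by (rule HOL.sym)
  qed
  then have "(\<Union>u'\<in>pres_class X R u. \<Union>v'\<in>pres_class X R v. pres_class X R (u' @ v'))
      = pres_class X R (u @ v)"
    using self by blast
  then show ?thesis
    by (simp add: presented_group_def)
qed

lemma pres_rel_inverse:
  "w \<in> gwords X \<Longrightarrow> (rev (map (\<lambda>(x, b). (x, \<not> b)) w) @ w, []) \<in> pres_rel X R"
proof (induction w)
  case Nil
  then show ?case by (simp add: pres_rel.refl)
next
  case (Cons a w)
  obtain x b where a: "a = (x, b)" by force
  have xw: "x \<in> X" "w \<in> gwords X" using Cons.prems a by (auto simp: gwords_def)
  let ?w' = "rev (map (\<lambda>(x, b). (x, \<not> b)) w)"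
  have w': "?w' \<in> gwords X" using xw by (auto simp: gwords_def)
  have c: "([(x, \<not> b), (x, b)], []) \<in> pres_rel X R"
    using pres_rel.cancel[OF xw(1), of "\<not> b" R] by simp
  have "(?w' @ ([(x, \<not> b), (x, b)] @ w), ?w' @ ([] @ w)) \<in> pres_rel X R"
    by (intro pres_rel.append pres_rel.refl c w' xw)
  then have "(?w' @ ([(x, \<not> b), (x, b)] @ w), []) \<in> pres_rel X R"
    using Cons.IH[OF xw(2)] by (simp add: pres_rel.trans[of _ "?w' @ w"])
  then show ?case by (simp add: a)
qed

lemma group_presented_group: "group (presented_group X R)"
proof (rule groupI)
  let ?G = "presented_group X R"
  have app: "u @ v \<in> gwords X" if "u \<in> gwords X" "v \<in> gwords X" for u v :: "'a gword"
    using that by (simp add: gwords_def)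
  have nil: "[] \<in> gwords X" by (simp add: gwords_def)
  show "x \<otimes>\<^bsub>?G\<^esub> y \<in> carrier ?G" if "x \<in> carrier ?G" "y \<in> carrier ?G" for x y
    using that by (auto simp: carrier_presented_group mult_presented_group app)
  show "\<one>\<^bsub>?G\<^esub> \<in> carrier ?G"
    by (auto simp: carrier_presented_group one_presented_group nil)
  show "x \<otimes>\<^bsub>?G\<^esub> y \<otimes>\<^bsub>?G\<^esub> z = x \<otimes>\<^bsub>?G\<^esub> (y \<otimes>\<^bsub>?G\<^esub> z)"
    if "x \<in> carrier ?G" "y \<in> carrier ?G" "z \<in> carrier ?G" for x y z
    using that by (auto simp: carrier_presented_group mult_presented_group app)
  show "\<one>\<^bsub>?G\<^esub> \<otimes>\<^bsub>?G\<^esub> x = x" if "x \<in> carrier ?G" for x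
    using that by (auto simp: carrier_presented_group one_presented_group mult_presented_group nil)
  show "\<exists>y\<in>carrier ?G. y \<otimes>\<^bsub>?G\<^esub> x = \<one>\<^bsub>?G\<^esub>" if x: "x \<in> carrier ?G" for x
  proof -
    obtain w where w: "w \<in> gwords X" "x = pres_class X R w"
      using x by (auto simp: carrier_presented_group)
    let ?w' = "rev (map (\<lambda>(x, b). (x, \<not> b)) w)"
    have w': "?w' \<in> gwords X" using w by (auto simp: gwords_def)
    have "pres_class X R ?w' \<otimes>\<^bsub>?G\<^esub> x = \<one>\<^bsub>?G\<^esub>"
      using pres_rel_inverse[OF w(1), of R] w w'
      by (simp add: mult_presented_group one_presented_group pres_class_eq_iff app nil)
    then show ?thesis
      using w' by (auto simp: carrier_presented_group)
  qed
qed

section \<open>Geodesic growth\<close>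

definition word_value :: "('g, 'm) monoid_scheme \<Rightarrow> 'g list \<Rightarrow> 'g" where
  "word_value G w = foldr (\<otimes>\<^bsub>G\<^esub>) w \<one>\<^bsub>G\<^esub>"

definition geodesic_word :: "('g, 'm) monoid_scheme \<Rightarrow> 'g set \<Rightarrow> 'g list \<Rightarrow> bool" where
  "geodesic_word G S w \<longleftrightarrow>
    w \<in> lists S \<and>
    \<not> (\<exists>w' \<in> lists S. length w' < length w \<and> word_value G w' = word_value G w)"

definition geodesic_growth_series :: "('g, 'm) monoid_scheme \<Rightarrow> 'g set \<Rightarrow> int fps" where
  "geodesic_growth_series G S = Abs_fps (\<lambda>n. int (card {w. geodesic_word G S w \<and> length w = n}))"

section \<open>Numbered graphs and their products\<close>

locale numbered_graph =
  fixes V :: "'a set" and E :: "'a set set" and N :: "'a \<Rightarrow> nat"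
  assumes finite_vertices: "finite V"
    and edges: "e \<in> E \<Longrightarrow> e \<subseteq> V \<and> card e = 2"
    and numbers_ge_2: "v \<in> V \<Longrightarrow> 2 \<le> N v"

definition NGP_relations ::
    "'a set \<Rightarrow> 'a set set \<Rightarrow> ('a \<Rightarrow> nat) \<Rightarrow> ('a gword \<times> 'a gword) set" where
  "NGP_relations V E N =
    {(replicate (N v) (v, True), []) | v. v \<in> V} \<union>
    {([(u, True), (v, True)], [(v, True), (u, True)]) | u v. {u, v} \<in> E}"

definition NGP :: "'a set \<Rightarrow> 'a set set \<Rightarrow> ('a \<Rightarrow> nat) \<Rightarrow> 'a gword set monoid" where
  "NGP V E N = presented_group V (NGP_relations V E N)"

definition NGP_generator :: "'a set \<Rightarrow> 'a set set \<Rightarrow> ('a \<Rightarrow> nat) \<Rightarrow> 'a \<Rightarrow> 'a gword set" where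
  "NGP_generator V E N v = pres_class V (NGP_relations V E N) [(v, True)]"

text \<open>
  The standard generating set consists of group elements, so that a generator of order 2 and its
  inverse count as one letter.
\<close>

definition NGP_standard_gens :: "'a set \<Rightarrow> 'a set set \<Rightarrow> ('a \<Rightarrow> nat) \<Rightarrow> 'a gword set set" where
  "NGP_standard_gens V E N =
    NGP_generator V E N ` V \<union> (\<lambda>v. inv\<^bsub>NGP V E N\<^esub> (NGP_generator V E N v)) ` V"

definition clique :: "'a set \<Rightarrow> 'a set set \<Rightarrow> 'a set \<Rightarrow> bool" where
  "clique V E \<sigma> \<longleftrightarrow> \<sigma> \<subseteq> V \<and> (\<forall>u\<in>\<sigma>. \<forall>v\<in>\<sigma>. u \<noteq> v \<longrightarrow> {u, v} \<in> E)"

definition link :: "'a set \<Rightarrow> 'a set set \<Rightarrow> 'a set \<Rightarrow> 'a set" where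
  "link V E \<sigma> = {v \<in> V - \<sigma>. clique V E (\<sigma> \<union> {v})}"

definition numbers :: "('a \<Rightarrow> nat) \<Rightarrow> 'a set \<Rightarrow> nat multiset" where
  "numbers N U = image_mset N (mset_set U)"

definition link_regular :: "'a set \<Rightarrow> 'a set set \<Rightarrow> ('a \<Rightarrow> nat) \<Rightarrow> bool" where
  "link_regular V E N \<longleftrightarrow>
    (\<forall>\<sigma>\<^sub>1 \<sigma>\<^sub>2. clique V E \<sigma>\<^sub>1 \<and> clique V E \<sigma>\<^sub>2 \<and> numbers N \<sigma>\<^sub>1 = numbers N \<sigma>\<^sub>2 \<longrightarrow>
      numbers N (link V E \<sigma>\<^sub>1) = numbers N (link V E \<sigma>\<^sub>2))"

definition equivalent_numbered_graphs ::
    "'a set \<Rightarrow> 'a set set \<Rightarrow> ('a \<Rightarrow> nat) \<Rightarrow> 'b set \<Rightarrow> 'b set set \<Rightarrow> ('b \<Rightarrow> nat) \<Rightarrow> bool" where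
  "equivalent_numbered_graphs V E N V' E' N' \<longleftrightarrow>
    numbers N V = numbers N' V' \<and>
    (\<forall>\<sigma> \<sigma>'. clique V E \<sigma> \<and> clique V' E' \<sigma>' \<and> numbers N \<sigma> = numbers N' \<sigma>' \<longrightarrow>
      numbers N (link V E \<sigma>) = numbers N' (link V' E' \<sigma>'))"

end

theory Submission
  imports Defs
begin

text \<open>
  The group acts on piles (in the style of Crisp, Godelle and Wiest), which shows that the length of
  an element is read off its pile and that appending a letter \<open>v\<close> or \<open>v\<inverse>\<close> lengthens the element
  in a way that depends only on the current exponent of \<open>v\<close> among the final syllables. Hence
  geodesics are the words accepted by an automaton whose states are cliques \<open>\<sigma>\<close> carrying nonzero
  exponents. The letters \<open>v \<notin> \<sigma>\<close> of a given order with \<open>\<tau> \<subseteq> Lk(v)\<close> are counted by the link of the subclique \<open>\<tau>\<close>,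
  so inclusion-exclusion over \<open>\<tau> \<subseteq> \<sigma>\<close> determines how many of them satisfy \<open>Lk(v) \<inter> \<sigma> = \<tau>\<close>.
  Therefore states of the two automata that match in orders and exponents admit equally many
  accepted words of each length.
\<close>

lemma word_value_Nil: "word_value G [] = \<one>\<^bsub>G\<^esub>"
  by (simp add: word_value_def)

lemma word_value_Cons: "word_value G (x # w) = x \<otimes>\<^bsub>G\<^esub> word_value G w"
  by (simp add: word_value_def)

section \<open>Piles and the action of vertex powers on them\<close>

context numbered_graph
begin

lemma no_loop: "{v} \<notin> E"
  using edges[of "{v}"] by auto

lemma N_pos: "v \<in> V \<Longrightarrow> 0 < N v"
  using numbers_ge_2[of v] by simp

text \<open>
  A pile assigns a stack to each vertex. A syllable \<open>v\<^sup>k\<close> puts the entry \<open>k\<close> on the stack of \<open>v\<close>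
  and the marker \<open>0\<close> on the stack of every other vertex not adjacent to \<open>v\<close>, so the value
  \<open>top_exp P v\<close> is nonzero iff \<open>P\<close> has a final \<open>v\<close>-syllable, whose exponent it then is.
\<close>

definition top_exp :: "('a \<Rightarrow> nat list) \<Rightarrow> 'a \<Rightarrow> nat" where
  "top_exp P v = (case P v of [] \<Rightarrow> 0 | k # _ \<Rightarrow> k)"

definition put :: "'a \<Rightarrow> nat \<Rightarrow> ('a \<Rightarrow> nat list) \<Rightarrow> 'a \<Rightarrow> nat list" where
  "put v k P = (\<lambda>u. if k = 0 then P u else if u = v then k # P u
    else if {u, v} \<in> E then P u else 0 # P u)"

text \<open>Undoes \<open>put\<close>: a final \<open>v\<close>-syllable goes away together with its
  markers. The vertex \<open>v\<close> itself reaches the last branch because \<open>{v}\<close> is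
  not an edge.\<close>

definition strip :: "'a \<Rightarrow> ('a \<Rightarrow> nat list) \<Rightarrow> 'a \<Rightarrow> nat list" where
  "strip v P = (\<lambda>u. if top_exp P v = 0 \<or> {u, v} \<in> E then P u else tl (P u))"

text \<open>Models right multiplication by the \<open>s\<close>-th power of \<open>v\<close>: only
  the exponent of the final \<open>v\<close>-syllable changes, and a syllable whose exponent becomes
  0 vanishes, as \<open>put v 0\<close> is the identity.\<close>

definition act :: "'a \<Rightarrow> nat \<Rightarrow> ('a \<Rightarrow> nat list) \<Rightarrow> 'a \<Rightarrow> nat list" where
  "act v s P = put v ((top_exp P v + s) mod N v) (strip v P)"

lemma put_0 [simp]: "put v 0 P = P"
  by (simp add: put_def)

lemma top_exp_put_self: "top_exp P v = 0 \<Longrightarrow> top_exp (put v k P) v = k"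
  by (simp add: top_exp_def put_def)

lemma top_exp_put_adjacent: "{u, v} \<in> E \<Longrightarrow> top_exp (put v k P) u = top_exp P u"
  using no_loop by (auto simp: top_exp_def put_def)

lemma top_exp_put_nonadjacent:
  "u \<noteq> v \<Longrightarrow> {u, v} \<notin> E \<Longrightarrow> k \<noteq> 0 \<Longrightarrow> top_exp (put v k P) u = 0"
  by (auto simp: top_exp_def put_def)

lemma put_commute: "{u, v} \<in> E \<Longrightarrow> put u j (put v k P) = put v k (put u j P)"
  using no_loop by (auto simp: put_def insert_commute fun_eq_iff)

lemma strip_put: "top_exp P v = 0 \<Longrightarrow> strip v (put v k P) = P"
  by (simp add: strip_def top_exp_put_self) (auto simp: put_def no_loop fun_eq_iff)

text \<open>The laws of \<open>act\<close> reduce to this formula once piles are known to have the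
  form \<open>put v k P\<close> with no final \<open>v\<close>-syllable in \<open>P\<close>.\<close>

lemma act_put:
  "top_exp P v = 0 \<Longrightarrow> act v s (put v k P) = put v ((k + s) mod N v) P"
  by (simp add: act_def strip_put top_exp_put_self)

section \<open>Generators, and the group elements represented by piles\<close>

abbreviation G where "G \<equiv> NGP V E N"
abbreviation gen where "gen \<equiv> NGP_generator V E N"

lemma group_NGP: "group G"
  unfolding NGP_def by (rule group_presented_group)

sublocale NGP: group "NGP V E N"
  by (rule group_NGP)

lemma gen_closed: "v \<in> V \<Longrightarrow> gen v \<in> carrier G"
  by (auto simp: NGP_generator_def NGP_def carrier_presented_group gwords_def)

lemma gen_pow:
  assumes "v \<in> V"
  shows "gen v [^]\<^bsub>G\<^esub> (n::nat) = pres_class V (NGP_relations V E N) (replicate n (v, True))"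
proof (induction n)
  case 0
  then show ?case by (simp add: NGP_def one_presented_group)
next
  case (Suc n)
  have "replicate n (v, True) \<in> gwords V" "[(v, True)] \<in> gwords V"
    using assms by (auto simp: gwords_def)
  then show ?case
    using Suc by (simp add: NGP_generator_def NGP_def mult_presented_group replicate_append_same)
qed

lemma gen_pow_N: "v \<in> V \<Longrightarrow> gen v [^]\<^bsub>G\<^esub> N v = \<one>\<^bsub>G\<^esub>"
proof -
  assume v: "v \<in> V"
  have "(replicate (N v) (v, True), []) \<in> pres_rel V (NGP_relations V E N)"
    by (rule pres_rel.relation) (use v in \<open>auto simp: NGP_relations_def gwords_def\<close>)
  moreover have "replicate (N v) (v, True) \<in> gwords V" "[] \<in> gwords V"
    using v by (auto simp: gwords_def)
  ultimately show ?thesis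
    using v by (simp add: gen_pow) (simp add: NGP_def one_presented_group pres_class_eq_iff)
qed

lemma gen_pow_mod:
  assumes "v \<in> V" shows "gen v [^]\<^bsub>G\<^esub> (n mod N v) = gen v [^]\<^bsub>G\<^esub> n"
proof -
  have "gen v [^]\<^bsub>G\<^esub> n = gen v [^]\<^bsub>G\<^esub> (N v * (n div N v) + n mod N v)"
    by simp
  also have "\<dots> = (gen v [^]\<^bsub>G\<^esub> N v) [^]\<^bsub>G\<^esub> (n div N v) \<otimes>\<^bsub>G\<^esub> gen v [^]\<^bsub>G\<^esub> (n mod N v)"
    by (simp only: NGP.nat_pow_mult[symmetric] NGP.nat_pow_pow gen_closed[OF assms])
  finally show ?thesis
    using assms by (simp add: gen_pow_N gen_closed)
qed

lemma edge_vertices: "{u, v} \<in> E \<Longrightarrow> u \<in> V \<and> v \<in> V"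
  using edges[of "{u, v}"] by auto

lemma gen_commute:
  assumes "{u, v} \<in> E"
  shows "gen u \<otimes>\<^bsub>G\<^esub> gen v = gen v \<otimes>\<^bsub>G\<^esub> gen u"
proof -
  have uv: "u \<in> V" "v \<in> V" using edge_vertices[OF assms] by auto
  have "([(u, True), (v, True)], [(v, True), (u, True)]) \<in> pres_rel V (NGP_relations V E N)"
    by (rule pres_rel.relation) (use uv assms in \<open>auto simp: NGP_relations_def gwords_def\<close>)
  then show ?thesis
    using uv by (simp add: NGP_generator_def NGP_def mult_presented_group pres_class_eq_iff gwords_def)
qed

lemma gen_pow_commute:
  assumes "{u, v} \<in> E"
  shows "gen u [^]\<^bsub>G\<^esub> (i::nat) \<otimes>\<^bsub>G\<^esub> gen v [^]\<^bsub>G\<^esub> (j::nat) = gen v [^]\<^bsub>G\<^esub> j \<otimes>\<^bsub>G\<^esub> gen u [^]\<^bsub>G\<^esub> i"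
proof -
  have uv: "gen u \<in> carrier G" "gen v \<in> carrier G"
    using edge_vertices[OF assms] gen_closed by auto
  have "gen u [^]\<^bsub>G\<^esub> i \<otimes>\<^bsub>G\<^esub> gen v = gen v \<otimes>\<^bsub>G\<^esub> gen u [^]\<^bsub>G\<^esub> i"
    by (rule NGP.group_commutes_pow[OF gen_commute[OF assms] uv])
  then show ?thesis
    using NGP.group_commutes_pow[of "gen v" "gen u [^]\<^bsub>G\<^esub> i" j] uv by simp
qed

inductive pile_of :: "('a \<Rightarrow> nat list) \<Rightarrow> 'a gword set \<Rightarrow> bool" where
  empty: "pile_of (\<lambda>_. []) \<one>\<^bsub>G\<^esub>"
| put: "pile_of P g \<Longrightarrow> v \<in> V \<Longrightarrow> top_exp P v = 0 \<Longrightarrow> k < N v \<Longrightarrow>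
    pile_of (put v k P) (g \<otimes>\<^bsub>G\<^esub> gen v [^]\<^bsub>G\<^esub> k)"

lemma pile_of_closed: "pile_of P g \<Longrightarrow> g \<in> carrier G"
  by (induction rule: pile_of.induct) (auto intro: gen_closed)

text \<open>A final \<open>v\<close>-syllable can be moved to the end. If the last syllable belongs
  to a neighbour of \<open>v\<close>, the two commute; if it belongs to another vertex not adjacent
  to \<open>v\<close>, its marker covers the stack of \<open>v\<close>, and exponent 0
  works.\<close>

lemma pile_of_decompose:
  assumes "pile_of P g" "v \<in> V"
  obtains Q h k where "pile_of Q h" "top_exp Q v = 0" "k < N v" "P = put v k Q"
    "g = h \<otimes>\<^bsub>G\<^esub> gen v [^]\<^bsub>G\<^esub> k"
proof -
  have "\<exists>Q h k. pile_of Q h \<and> top_exp Q v = 0 \<and> k < N v \<and> P = put v k Q \<and>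
    g = h \<otimes>\<^bsub>G\<^esub> gen v [^]\<^bsub>G\<^esub> k"
    using assms
  proof (induction rule: pile_of.induct)
    case empty
    have "top_exp (\<lambda>_. []) v = 0" by (simp add: top_exp_def)
    then show ?case
      using pile_of.empty N_pos[OF \<open>v \<in> V\<close>]
      by (intro exI[of _ "\<lambda>_. []"] exI[of _ "\<one>\<^bsub>G\<^esub>"] exI[of _ 0]) simp
  next
    case (put P g u k)
    have gc: "g \<in> carrier G" using put.hyps(1) by (rule pile_of_closed)
    have xc: "gen u \<in> carrier G" "gen v \<in> carrier G"
      using put gen_closed by auto
    show ?case
    proof (cases "u = v")
      case True
      then show ?thesis using put by blast
    next
      case False
      obtain Q h j where IH: "pile_of Q h" "top_exp Q v = 0" "j < N v" "P = put v j Q"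
          "g = h \<otimes>\<^bsub>G\<^esub> gen v [^]\<^bsub>G\<^esub> j"
        using put by blast
      have hc: "h \<in> carrier G" using IH(1) by (rule pile_of_closed)
      consider "k = 0" | "k \<noteq> 0" "{u, v} \<in> E" | "k \<noteq> 0" "{u, v} \<notin> E" by blast
      then show ?thesis
      proof cases
        case 1
        then show ?thesis using IH gc by auto
      next
        case 2
        have "top_exp Q u = 0"
          using put.hyps(3) 2 IH(4) by (simp add: top_exp_put_adjacent)
        then have "pile_of (put u k Q) (h \<otimes>\<^bsub>G\<^esub> gen u [^]\<^bsub>G\<^esub> k)"
          using IH(1) put.hyps by (intro pile_of.put)
        moreover have "top_exp (put u k Q) v = 0"
          using 2 IH(2) by (simp add: top_exp_put_adjacent insert_commute)
        moreover have "put u k P = put v j (put u k Q)"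
          unfolding IH(4) by (rule put_commute[OF 2(2)])
        moreover have "g \<otimes>\<^bsub>G\<^esub> gen u [^]\<^bsub>G\<^esub> k = h \<otimes>\<^bsub>G\<^esub> gen u [^]\<^bsub>G\<^esub> k \<otimes>\<^bsub>G\<^esub> gen v [^]\<^bsub>G\<^esub> j"
          using IH(5) hc xc gen_pow_commute[OF 2(2), of k j] by (simp add: NGP.m_assoc)
        ultimately show ?thesis using IH(3) by blast
      next
        case 3
        then have "top_exp (put u k P) v = 0"
          using False by (intro top_exp_put_nonadjacent) (auto simp: insert_commute)
        moreover have "pile_of (put u k P) (g \<otimes>\<^bsub>G\<^esub> gen u [^]\<^bsub>G\<^esub> k)"
          using put.hyps by (intro pile_of.put)
        ultimately show ?thesis
          using N_pos[OF \<open>v \<in> V\<close>] gc xc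
          by (intro exI[of _ "put u k P"] exI[of _ "g \<otimes>\<^bsub>G\<^esub> gen u [^]\<^bsub>G\<^esub> k"] exI[of _ 0]) simp
      qed
    qed
  qed
  then show thesis using that by blast
qed

lemma pile_of_act:
  assumes "pile_of P g" "v \<in> V"
  shows "pile_of (act v s P) (g \<otimes>\<^bsub>G\<^esub> gen v [^]\<^bsub>G\<^esub> s)"
proof -
  obtain Q h k where Q: "pile_of Q h" "top_exp Q v = 0" "k < N v" "P = put v k Q"
      "g = h \<otimes>\<^bsub>G\<^esub> gen v [^]\<^bsub>G\<^esub> k"
    using assms by (rule pile_of_decompose)
  have "h \<in> carrier G" using Q(1) by (rule pile_of_closed)
  then have "g \<otimes>\<^bsub>G\<^esub> gen v [^]\<^bsub>G\<^esub> s = h \<otimes>\<^bsub>G\<^esub> gen v [^]\<^bsub>G\<^esub> ((k + s) mod N v)"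
    using assms(2) Q(5) by (simp add: gen_pow_mod NGP.m_assoc NGP.nat_pow_mult gen_closed)
  moreover have "act v s P = put v ((k + s) mod N v) Q"
    using Q by (simp add: act_put)
  ultimately show ?thesis
    using pile_of.put[OF Q(1) assms(2) Q(2), of "(k + s) mod N v"] N_pos[OF assms(2)] by simp
qed

section \<open>The action of the group on valid piles\<close>

definition valid :: "('a \<Rightarrow> nat list) \<Rightarrow> bool" where
  "valid P \<longleftrightarrow> (\<exists>g. pile_of P g)"

lemma valid_empty: "valid (\<lambda>_. [])"
  using pile_of.empty valid_def by blast

lemma valid_act: "valid P \<Longrightarrow> v \<in> V \<Longrightarrow> valid (act v s P)"
  using pile_of_act valid_def by blast

lemma valid_decompose:
  assumes "valid P" "v \<in> V"
  obtains Q k where "valid Q" "top_exp Q v = 0" "k < N v" "P = put v k Q"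
  using assms pile_of_decompose valid_def by metis

lemma act_act:
  assumes "valid P" "v \<in> V"
  shows "act v s (act v t P) = act v (t + s) P"
proof -
  obtain Q k where "top_exp Q v = 0" "P = put v k Q"
    using assms by (rule valid_decompose)
  then show ?thesis by (simp add: act_put mod_simps add.assoc)
qed

text \<open>Validity matters here: on arbitrary stacks, an entry of at least \<open>N v\<close>
  would be reduced, and missing markers would be added.\<close>

lemma act_N:
  assumes "valid P" "v \<in> V"
  shows "act v (N v) P = P"
proof -
  obtain Q k where "top_exp Q v = 0" "P = put v k Q" "k < N v"
    using assms by (rule valid_decompose)
  then show ?thesis by (simp add: act_put)
qed

lemma act_0:
  assumes "valid P" "v \<in> V"
  shows "act v 0 P = P"
proof -
  obtain Q k where "top_exp Q v = 0" "P = put v k Q" "k < N v"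
    using assms by (rule valid_decompose)
  then show ?thesis by (simp add: act_put)
qed

text \<open>Taking both final syllables off leaves a pile \<open>T\<close> without final
  \<open>u\<close>- or \<open>v\<close>-syllable; on \<open>put v j (put u k T)\<close> the two
  actions change the two exponents independently.\<close>

lemma act_commute:
  assumes "valid P" "{u, v} \<in> E"
  shows "act u s (act v t P) = act v t (act u s P)"
proof -
  have uv: "u \<in> V" "v \<in> V" using edge_vertices[OF assms(2)] by auto
  have vu: "{v, u} \<in> E" using assms(2) by (simp add: insert_commute)
  obtain Q k where Q: "valid Q" "top_exp Q u = 0" "P = put u k Q"
    using assms(1) uv(1) by (rule valid_decompose)
  obtain T j where T: "top_exp T v = 0" "Q = put v j T"
    using Q(1) uv(2) by (rule valid_decompose)
  have "top_exp T u = 0"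
    using Q(2) T(2) assms(2) by (simp add: top_exp_put_adjacent)
  then have "act u s (put v b (put u a T)) = put v b (put u ((a + s) mod N u) T)" for a b
    using assms(2) T vu by (simp add: put_commute[OF vu] act_put top_exp_put_adjacent)
  moreover have "act v t (put v b (put u a T)) = put v ((b + t) mod N v) (put u a T)" for a b
    using T vu by (simp add: act_put top_exp_put_adjacent)
  moreover have "P = put v j (put u k T)"
    unfolding Q(3) T(2) by (rule put_commute[OF assms(2)])
  ultimately show ?thesis by simp
qed

text \<open>Words are read from left to right, which gives a right action. A formal inverse acts as
  the power \<open>N v - 1\<close>.\<close>

definition gword_act :: "'a gword \<Rightarrow> ('a \<Rightarrow> nat list) \<Rightarrow> 'a \<Rightarrow> nat list" where
  "gword_act = fold (\<lambda>(v, b). act v (if b then 1 else N v - 1))"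

lemma gword_act_append: "gword_act (u @ w) P = gword_act w (gword_act u P)"
  by (simp add: gword_act_def)

lemma valid_gword_act: "w \<in> gwords V \<Longrightarrow> valid P \<Longrightarrow> valid (gword_act w P)"
  by (induction w arbitrary: P) (auto simp: gword_act_def gwords_def valid_act)

lemma gword_act_replicate:
  "valid P \<Longrightarrow> v \<in> V \<Longrightarrow> gword_act (replicate n (v, True)) P = act v n P"
  by (induction n arbitrary: P) (simp_all add: gword_act_def act_0 valid_act act_act)

text \<open>The action satisfies the defining relations, so it descends to the presented group. This
  is what makes piles invariants of group elements.\<close>

lemma gword_act_pres_rel:
  "(u, w) \<in> pres_rel V (NGP_relations V E N) \<Longrightarrow> valid P \<Longrightarrow> gword_act u P = gword_act w P"
proof (induction arbitrary: P rule: pres_rel.induct)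
  case (append u u' v v')
  then show ?case
    using pres_rel_gwords valid_gword_act by (metis gword_act_append)
next
  case (cancel x b)
  \<comment> \<open>In either order, the two letters add up to the exponent
    \<open>N x\<close>.\<close>
  then have "act x (Suc (N x - Suc 0)) P = P"
    using N_pos[of x] by (simp add: act_N)
  then show ?case
    using cancel N_pos[of x] by (auto simp: gword_act_def act_act)
next
  case (relation l r)
  then show ?case
    unfolding NGP_relations_def
    by (auto simp: gword_act_replicate act_N) (auto simp: gword_act_def intro: act_commute[symmetric])
qed auto

section \<open>Words in the standard letters\<close>

text \<open>
  The pair \<open>(v, s)\<close> encodes the letter \<open>v\<^sup>s\<close>; the two letters of a vertex of order 2 are the same pair.
\<close>

definition letters :: "('a \<times> nat) set" where
  "letters = {(v, s). v \<in> V \<and> (s = 1 \<or> s = N v - 1)}"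

definition letter_value :: "'a \<times> nat \<Rightarrow> 'a gword set" where
  "letter_value = (\<lambda>(v, s). gen v [^]\<^bsub>G\<^esub> s)"

definition run :: "('a \<times> nat) list \<Rightarrow> ('a \<Rightarrow> nat list) \<Rightarrow> 'a \<Rightarrow> nat list" where
  "run = fold (\<lambda>(v, s). act v s)"

lemma letter_value_closed: "x \<in> letters \<Longrightarrow> letter_value x \<in> carrier G"
  by (auto simp: letters_def letter_value_def gen_closed)

lemma finite_letters: "finite letters"
proof -
  have "letters \<subseteq> (\<lambda>v. (v, 1)) ` V \<union> (\<lambda>v. (v, N v - 1)) ` V"
    by (auto simp: letters_def)
  then show ?thesis using finite_vertices finite_subset by blast
qed

lemma inv_gen:
  assumes "v \<in> V" shows "inv\<^bsub>G\<^esub> gen v = gen v [^]\<^bsub>G\<^esub> (N v - 1)"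
proof (rule NGP.inv_equality)
  have "gen v [^]\<^bsub>G\<^esub> (N v - 1) \<otimes>\<^bsub>G\<^esub> gen v = gen v [^]\<^bsub>G\<^esub> (Suc (N v - 1))"
    by simp
  then show "gen v [^]\<^bsub>G\<^esub> (N v - 1) \<otimes>\<^bsub>G\<^esub> gen v = \<one>\<^bsub>G\<^esub>"
    using assms N_pos[OF assms] gen_pow_N by (simp del: nat_pow_Suc)
qed (use assms in \<open>auto simp: gen_closed\<close>)

lemma standard_gens_eq: "NGP_standard_gens V E N = letter_value ` letters"
proof -
  have "letters = (\<lambda>v. (v, 1)) ` V \<union> (\<lambda>v. (v, N v - 1)) ` V"
    by (auto simp: letters_def)
  then show ?thesis
    by (simp add: NGP_standard_gens_def letter_value_def image_Un image_image inv_gen gen_closed)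
qed

abbreviation eval_word :: "('a \<times> nat) list \<Rightarrow> 'a gword set" where
  "eval_word ws \<equiv> word_value G (map letter_value ws)"

lemma eval_word_closed: "ws \<in> lists letters \<Longrightarrow> eval_word ws \<in> carrier G"
  by (induction ws) (auto simp: word_value_Nil word_value_Cons letter_value_closed)

lemma eval_word_append:
  "u \<in> lists letters \<Longrightarrow> w \<in> lists letters \<Longrightarrow> eval_word (u @ w) = eval_word u \<otimes>\<^bsub>G\<^esub> eval_word w"
  by (induction u)
    (auto simp: word_value_Nil word_value_Cons eval_word_closed letter_value_closed NGP.m_assoc)

lemma pile_of_run:
  "ws \<in> lists letters \<Longrightarrow> pile_of P g \<Longrightarrow> pile_of (run ws P) (g \<otimes>\<^bsub>G\<^esub> eval_word ws)"
proof (induction ws arbitrary: P g)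
  case Nil
  then show ?case by (simp add: run_def word_value_Nil pile_of_closed)
next
  case (Cons x ws)
  obtain v s where x: "x = (v, s)" by force
  then have v: "v \<in> V" using Cons.prems by (auto simp: letters_def)
  have ws: "ws \<in> lists letters" using Cons.prems by simp
  have "pile_of (run ws (act v s P)) (g \<otimes>\<^bsub>G\<^esub> gen v [^]\<^bsub>G\<^esub> s \<otimes>\<^bsub>G\<^esub> eval_word ws)"
    using Cons.IH[OF ws] pile_of_act[OF Cons.prems(2) v] by blast
  moreover have "letter_value x = gen v [^]\<^bsub>G\<^esub> s"
    by (simp add: x letter_value_def)
  ultimately show ?case
    using x v ws Cons.prems
    by (simp add: run_def word_value_Cons NGP.m_assoc pile_of_closed gen_closed eval_word_closed)
qed

lemma pile_of_run_empty: "ws \<in> lists letters \<Longrightarrow> pile_of (run ws (\<lambda>_. [])) (eval_word ws)"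
  using pile_of_run[OF _ pile_of.empty] by (simp add: eval_word_closed)

text \<open>Spelling each letter \<open>(v, s)\<close> as \<open>s\<close> copies of
  \<open>(v, True)\<close> gives a word over the presentation, to which
  \<open>gword_act_pres_rel\<close> applies.\<close>

lemma run_eq_gword_act:
  assumes "ws \<in> lists letters"
  obtains w where "w \<in> gwords V" "eval_word ws = pres_class V (NGP_relations V E N) w"
    "\<And>P. valid P \<Longrightarrow> run ws P = gword_act w P"
proof -
  have "\<exists>w. w \<in> gwords V \<and> eval_word ws = pres_class V (NGP_relations V E N) w \<and>
    (\<forall>P. valid P \<longrightarrow> run ws P = gword_act w P)"
    using assms
  proof (induction ws)
    case Nil
    show ?case
      by (intro exI[of _ "[]"])
        (simp add: gwords_def word_value_Nil NGP_def one_presented_group run_def gword_act_def)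
  next
    case (Cons x ws)
    then obtain w where w: "w \<in> gwords V" "eval_word ws = pres_class V (NGP_relations V E N) w"
        "\<And>P. valid P \<Longrightarrow> run ws P = gword_act w P"
      by auto
    obtain v s where x: "x = (v, s)" by force
    then have v: "v \<in> V" using Cons by (auto simp: letters_def)
    have r: "replicate s (v, True) \<in> gwords V" using v by (auto simp: gwords_def)
    have "replicate s (v, True) @ w \<in> gwords V"
      using r w by (simp add: gwords_def)
    moreover have "eval_word (x # ws) = pres_class V (NGP_relations V E N) (replicate s (v, True) @ w)"
      using r w v x by (simp add: word_value_Cons letter_value_def gen_pow)
        (simp add: NGP_def mult_presented_group)
    moreover have "run (x # ws) P = gword_act (replicate s (v, True) @ w) P" if "valid P" for P
      using that w(3)[OF valid_act[OF that v]] v x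
      by (simp add: gword_act_append gword_act_replicate) (simp add: run_def)
    ultimately show ?case by blast
  qed
  then show thesis using that by blast
qed

text \<open>Words of equal value have spellings related by \<open>pres_rel\<close>. Started from the
  empty pile, \<open>run\<close> therefore yields a pile that depends only on the group
  element.\<close>

lemma run_cong:
  assumes "u \<in> lists letters" "w \<in> lists letters" "eval_word u = eval_word w" "valid P"
  shows "run u P = run w P"
proof -
  obtain u' where u': "u' \<in> gwords V" "eval_word u = pres_class V (NGP_relations V E N) u'"
      "run u P = gword_act u' P"
    using run_eq_gword_act[OF assms(1)] assms(4) by metis
  obtain w' where w': "w' \<in> gwords V" "eval_word w = pres_class V (NGP_relations V E N) w'"
      "run w P = gword_act w' P"
    using run_eq_gword_act[OF assms(2)] assms(4) by metis
  show ?thesis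
    using u' w' assms gword_act_pres_rel pres_class_eq_iff by metis
qed

text \<open>Distinct letters already produce distinct piles from the empty one. Hence words over the
  generating set can be counted as lists of pairs.\<close>

lemma inj_on_letter_value: "inj_on letter_value letters"
proof (rule inj_onI)
  fix x y assume xy: "x \<in> letters" "y \<in> letters" "letter_value x = letter_value y"
  obtain v s u t where vs: "x = (v, s)" "y = (u, t)" by force
  have V: "v \<in> V" "u \<in> V" using xy vs by (auto simp: letters_def)
  have N2: "2 \<le> N v" "2 \<le> N u" using V numbers_ge_2 by auto
  then have s: "0 < s" "s < N v" "0 < t" "t < N u"
    using xy vs V by (auto simp: letters_def)
  have run: "run [(v, s)] (\<lambda>_. []) = put v s (\<lambda>_. [])" if "s < N v" for v s
    using act_put[of "\<lambda>_. []" v s 0] that by (simp add: run_def top_exp_def)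
  have "run [x] (\<lambda>_. []) = run [y] (\<lambda>_. [])"
    using xy by (intro run_cong valid_empty) (auto simp: word_value_Cons)
  then have "put v s (\<lambda>_. []) w = put u t (\<lambda>_. []) w" for w
    using run s vs by metis
  \<comment> \<open>The stack of \<open>v\<close> is \<open>[s]\<close> with \<open>0 < s\<close> on
    the left; on the right it would be \<open>[]\<close> or \<open>[0]\<close> if \<open>u\<close>
    and \<open>v\<close> differed.\<close>
  from this[of v] show "x = y"
    using s vs by (auto simp: put_def split: if_splits)
qed

section \<open>Length of piles and the recognition of geodesics\<close>

definition exp_length :: "'a \<Rightarrow> nat \<Rightarrow> nat" where
  "exp_length v k = min k (N v - k)"

definition pile_length :: "('a \<Rightarrow> nat list) \<Rightarrow> nat" where
  "pile_length P = (\<Sum>v\<in>V. sum_list (map (exp_length v) (P v)))"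

lemma pile_length_empty: "pile_length (\<lambda>_. []) = 0"
  by (simp add: pile_length_def)

lemma exp_length_0 [simp]: "exp_length v 0 = 0"
  by (simp add: exp_length_def)

lemma pile_length_put:
  assumes "v \<in> V" shows "pile_length (put v k P) = pile_length P + exp_length v k"
proof (cases "k = 0")
  case False
  have "pile_length (put v k P) =
      (\<Sum>u\<in>V. sum_list (map (exp_length u) (P u)) + (if u = v then exp_length v k else 0))"
    unfolding pile_length_def using False by (intro sum.cong) (auto simp: put_def)
  then show ?thesis
    using assms finite_vertices by (simp add: sum.distrib pile_length_def)
qed simp

text \<open>For \<open>k < N v\<close>, \<open>exp_length v k\<close> is the distance from 0 to
  \<open>k\<close> on a cycle of length \<open>N v\<close>, along which a letter moves the exponent
  by one step.\<close>

lemma exp_length_step: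
  assumes "(v, s) \<in> letters" "k < N v"
  shows "exp_length v ((k + s) mod N v) \<le> Suc (exp_length v k)"
proof -
  have N2: "2 \<le> N v" using assms numbers_ge_2 by (auto simp: letters_def)
  show ?thesis
  proof (cases "k + s < N v")
    case True
    then show ?thesis using assms N2 by (auto simp: letters_def exp_length_def)
  next
    case False
    then have "(k + s) mod N v = k + s - N v"
      using assms N2 by (subst mod_if) (auto simp: letters_def)
    then show ?thesis using assms N2 False by (auto simp: letters_def exp_length_def)
  qed
qed

text \<open>Only the final \<open>v\<close>-syllable changes its length, since markers have length
  0. Sums on both sides avoid truncated subtraction.\<close>

lemma pile_length_act:
  assumes "valid P" "(v, s) \<in> letters"
  shows "pile_length (act v s P) + exp_length v (top_exp P v)
    = pile_length P + exp_length v ((top_exp P v + s) mod N v)"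
    and "pile_length (act v s P) \<le> Suc (pile_length P)"
proof -
  have v: "v \<in> V" using assms by (auto simp: letters_def)
  obtain Q k where Q: "top_exp Q v = 0" "k < N v" "P = put v k Q"
    using assms(1) v by (rule valid_decompose)
  show "pile_length (act v s P) + exp_length v (top_exp P v)
    = pile_length P + exp_length v ((top_exp P v + s) mod N v)"
    using Q v by (simp add: act_put pile_length_put top_exp_put_self)
  then show "pile_length (act v s P) \<le> Suc (pile_length P)"
    using exp_length_step[OF assms(2) Q(2)] Q by (simp add: top_exp_put_self)
qed

lemma pile_length_run:
  "ws \<in> lists letters \<Longrightarrow> valid P \<Longrightarrow> pile_length (run ws P) \<le> pile_length P + length ws"
proof (induction ws arbitrary: P)
  case Nil
  then show ?case by (simp add: run_def)
next
  case (Cons x ws)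
  obtain v s where x: "x = (v, s)" by force
  have "v \<in> V" "ws \<in> lists letters" "(v, s) \<in> letters"
    using Cons.prems x by (auto simp: letters_def)
  then show ?case
    using Cons.IH[of "act v s P"] pile_length_act(2)[of P v s] Cons.prems valid_act[of P v s] x
    by (simp add: run_def)
qed

text \<open>Go the shorter way round the cycle: \<open>k\<close> letters \<open>v\<close>, or
  \<open>N v - k\<close> letters inverse to \<open>v\<close>.\<close>

lemma gen_pow_word:
  assumes "v \<in> V" "k < N v"
  obtains ws where "ws \<in> lists letters" "length ws = exp_length v k" "eval_word ws = gen v [^]\<^bsub>G\<^esub> k"
proof -
  have rep: "eval_word (replicate n (v, s)) = (gen v [^]\<^bsub>G\<^esub> s) [^]\<^bsub>G\<^esub> n" for n s
  proof (induction n)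
    case (Suc n)
    then show ?case
      using NGP.nat_pow_Suc2[of "gen v [^]\<^bsub>G\<^esub> s" n] assms
      by (simp add: word_value_def letter_value_def gen_closed)
  qed (simp add: word_value_def)
  have lists: "replicate n (v, s) \<in> lists letters" if "s = 1 \<or> s = N v - 1" for n s
    using assms that by (auto simp: letters_def)
  show thesis
  proof (cases "k \<le> N v - k")
    case True
    then show thesis
      using that[OF lists, of 1 k] rep[of k 1] assms by (simp add: exp_length_def gen_closed)
  next
    case False
    define m where "m = N v - k"
    have "(N v - 1) * m mod N v = k"
    proof -
      \<comment> \<open>The congruence of \<open>-m\<close> and \<open>k\<close> modulo
        \<open>N v\<close> is made explicit in the naturals as
        \<open>(N v - 1) * m = k + N v * (N v - 1 - k)\<close>.\<close>
      obtain j where "N v = k + Suc j"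
        using assms(2) less_iff_Suc_add by auto
      then have "k + N v * (N v - 1 - k) = (N v - 1) * m"
        by (simp add: m_def algebra_simps)
      moreover have "(k + N v * (N v - 1 - k)) mod N v = k"
        using assms by simp
      ultimately show ?thesis by simp
    qed
    then have "gen v [^]\<^bsub>G\<^esub> ((N v - 1) * m) = gen v [^]\<^bsub>G\<^esub> k"
      using gen_pow_mod[OF assms(1), of "(N v - 1) * m"] by simp
    then show thesis
      using that[OF lists, of "N v - 1" m] rep[of m "N v - 1"] assms False
      by (simp add: exp_length_def gen_closed m_def NGP.nat_pow_pow)
  qed
qed

text \<open>Writing every syllable by the word of \<open>gen_pow_word\<close> attains the lower
  bound that \<open>pile_length_run\<close> puts on the length of words.\<close>

lemma pile_of_word:
  "pile_of P g \<Longrightarrow> \<exists>ws \<in> lists letters. length ws = pile_length P \<and> eval_word ws = g"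
proof (induction rule: pile_of.induct)
  case empty
  show ?case by (intro bexI[of _ "[]"]) (simp_all add: word_value_Nil pile_length_empty)
next
  case (put P g v k)
  then obtain ws where ws: "ws \<in> lists letters" "length ws = pile_length P" "eval_word ws = g"
    by blast
  obtain w where w: "w \<in> lists letters" "length w = exp_length v k" "eval_word w = gen v [^]\<^bsub>G\<^esub> k"
    using put.hyps(2,4) by (rule gen_pow_word)
  show ?case
    using ws w put.hyps(2)
    by (intro bexI[of _ "ws @ w"])
      (simp_all add: eval_word_append pile_length_put del: map_append)
qed

lemma lists_standard_gens: "lists (NGP_standard_gens V E N) = map letter_value ` lists letters"
  by (simp add: standard_gens_eq lists_image)

text \<open>The pile length is the length of the element: by \<open>run_cong\<close> and
  \<open>pile_length_run\<close> no word for it is shorter, and \<open>pile_of_word\<close> supplies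
  one of exactly that length.\<close>

lemma geodesic_word_iff:
  assumes "ws \<in> lists letters"
  shows "geodesic_word G (NGP_standard_gens V E N) (map letter_value ws) \<longleftrightarrow>
    pile_length (run ws (\<lambda>_. [])) = length ws"
proof -
  have le: "pile_length (run ws (\<lambda>_. [])) \<le> length w"
    if "w \<in> lists letters" "eval_word w = eval_word ws" for w
    using that pile_length_run[OF that(1) valid_empty] run_cong[OF that(1) assms that(2) valid_empty]
    by (simp add: pile_length_empty)
  obtain w where w: "w \<in> lists letters" "length w = pile_length (run ws (\<lambda>_. []))"
      "eval_word w = eval_word ws"
    using pile_of_word[OF pile_of_run_empty[OF assms]] by blast
  have "geodesic_word G (NGP_standard_gens V E N) (map letter_value ws) \<longleftrightarrow>
    \<not> (\<exists>w\<in>lists letters. length w < length ws \<and> eval_word w = eval_word ws)"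
    unfolding geodesic_word_def lists_standard_gens using assms by auto
  also have "\<dots> \<longleftrightarrow> pile_length (run ws (\<lambda>_. [])) = length ws"
    using le w assms by (metis le_neq_implies_less not_le)
  finally show ?thesis .
qed

section \<open>The automaton of final exponents\<close>

definition next_state :: "('a \<Rightarrow> nat) \<Rightarrow> 'a \<times> nat \<Rightarrow> 'a \<Rightarrow> nat" where
  "next_state e = (\<lambda>(v, s) u. if u = v then (e v + s) mod N v else if {u, v} \<in> E then e u else 0)"

definition step_ok :: "('a \<Rightarrow> nat) \<Rightarrow> 'a \<times> nat \<Rightarrow> bool" where
  "step_ok e = (\<lambda>(v, s). exp_length v ((e v + s) mod N v) = Suc (exp_length v (e v)))"

fun accepted :: "('a \<Rightarrow> nat) \<Rightarrow> ('a \<times> nat) list \<Rightarrow> bool" where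
  "accepted e [] \<longleftrightarrow> True"
| "accepted e (x # ws) \<longleftrightarrow> step_ok e x \<and> accepted (next_state e x) ws"

text \<open>A lengthening step leaves a nonzero exponent at \<open>v\<close>, whose syllable covers
  all vertices not adjacent to \<open>v\<close>. A step that cancelled the syllable could uncover
  earlier exponents, which the state does not record.\<close>

lemma top_exp_act:
  assumes "valid P" "v \<in> V" "step_ok (top_exp P) (v, s)"
  shows "top_exp (act v s P) = next_state (top_exp P) (v, s)"
proof -
  obtain Q k where Q: "top_exp Q v = 0" "k < N v" "P = put v k Q"
    using assms(1,2) by (rule valid_decompose)
  have k: "top_exp P v = k" using Q by (simp add: top_exp_put_self)
  then have "exp_length v ((k + s) mod N v) \<noteq> 0"
    using assms(3) by (simp add: step_ok_def)
  then have nz: "(k + s) mod N v \<noteq> 0"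
    by (metis exp_length_0)
  show ?thesis
  proof (rule ext)
    fix u
    show "top_exp (act v s P) u = next_state (top_exp P) (v, s) u"
      using Q k nz
      by (auto simp: act_put next_state_def top_exp_put_self top_exp_put_adjacent
          top_exp_put_nonadjacent no_loop)
  qed
qed

text \<open>Each letter adds at most one to the length, so a single step without growth can never be
  made up for; while every step grows, \<open>next_state\<close> follows
  \<open>top_exp\<close>.\<close>

lemma pile_length_run_iff:
  "ws \<in> lists letters \<Longrightarrow> valid P \<Longrightarrow>
    pile_length (run ws P) = pile_length P + length ws \<longleftrightarrow> accepted (top_exp P) ws"
proof (induction ws arbitrary: P)
  case Nil
  then show ?case by (simp add: run_def)
next
  case (Cons x ws)
  obtain v s where x: "x = (v, s)" by force
  have v: "v \<in> V" "ws \<in> lists letters" "(v, s) \<in> letters"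
    using Cons.prems x by (auto simp: letters_def)
  have val: "valid (act v s P)" using Cons.prems v by (simp add: valid_act)
  have ok: "step_ok (top_exp P) x \<longleftrightarrow> pile_length (act v s P) = Suc (pile_length P)"
    using pile_length_act(1)[OF Cons.prems(2) v(3)] x by (auto simp: step_ok_def)
  have run: "run (x # ws) P = run ws (act v s P)" by (simp add: x run_def)
  show ?case
  proof (cases "step_ok (top_exp P) x")
    case True
    then show ?thesis
      using Cons.IH[OF v(2) val] ok top_exp_act[OF Cons.prems(2) v(1), of s] x run by simp
  next
    case False
    then show ?thesis
      using ok pile_length_act(2)[OF Cons.prems(2) v(3)] pile_length_run[OF v(2) val] run
      by simp
  qed
qed

definition accepted_words :: "('a \<Rightarrow> nat) \<Rightarrow> nat \<Rightarrow> ('a \<times> nat) list set" where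
  "accepted_words e n = {ws \<in> lists letters. length ws = n \<and> accepted e ws}"

lemma card_geodesic_words:
  "card {w. geodesic_word G (NGP_standard_gens V E N) w \<and> length w = n}
    = card (accepted_words (\<lambda>_. 0) n)"
proof -
  have iff: "geodesic_word G (NGP_standard_gens V E N) (map letter_value ws) \<longleftrightarrow> accepted (\<lambda>_. 0) ws"
    if "ws \<in> lists letters" for ws
  proof -
    have "top_exp (\<lambda>_. []) = (\<lambda>_. 0)" by (auto simp: top_exp_def)
    then show ?thesis
      using geodesic_word_iff[OF that] pile_length_run_iff[OF that valid_empty]
      by (simp add: pile_length_empty)
  qed
  have lifts: "w \<in> map letter_value ` lists letters"
    if "geodesic_word G (NGP_standard_gens V E N) w" for w
    using that unfolding geodesic_word_def lists_standard_gens by simp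
  have "{w. geodesic_word G (NGP_standard_gens V E N) w \<and> length w = n}
      = map letter_value ` {ws \<in> lists letters.
          geodesic_word G (NGP_standard_gens V E N) (map letter_value ws) \<and> length ws = n}" (is "?L = ?R")
  proof (intro equalityI subsetI)
    fix w assume w: "w \<in> ?L"
    then obtain ws where "ws \<in> lists letters" "w = map letter_value ws"
      using lifts by blast
    then show "w \<in> ?R" using w by auto
  qed auto
  also have "\<dots> = map letter_value ` accepted_words (\<lambda>_. 0) n"
    unfolding accepted_words_def using iff by (intro arg_cong[where f = "image _"]) auto
  finally have "{w. geodesic_word G (NGP_standard_gens V E N) w \<and> length w = n}
      = map letter_value ` accepted_words (\<lambda>_. 0) n" .
  moreover have "inj_on (map letter_value) (accepted_words (\<lambda>_. 0) n)"
    by (rule inj_on_subset[OF inj_on_map_lists[OF inj_on_letter_value]])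
      (auto simp: accepted_words_def)
  ultimately show ?thesis by (simp add: card_image)
qed

lemma finite_accepted_words: "finite (accepted_words e n)"
  by (rule finite_subset[OF _ finite_lists_length_eq[OF finite_letters, of n]])
    (auto simp: accepted_words_def)

lemma card_accepted_words_Suc:
  "card (accepted_words e (Suc n))
    = (\<Sum>x\<in>letters. if step_ok e x then card (accepted_words (next_state e x) n) else 0)"
proof -
  let ?A = "{x \<in> letters. step_ok e x}"
  have "accepted_words e (Suc n)
      = (\<lambda>(x, ws). x # ws) ` (SIGMA x:?A. accepted_words (next_state e x) n)"
    by (auto simp: accepted_words_def length_Suc_conv image_iff)
  moreover have "inj_on (\<lambda>(x, ws). x # ws) (SIGMA x:?A. accepted_words (next_state e x) n)"
    by (auto simp: inj_on_def)
  ultimately have "card (accepted_words e (Suc n))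
      = card (SIGMA x:?A. accepted_words (next_state e x) n)"
    by (simp add: card_image)
  also have "\<dots> = (\<Sum>x\<in>?A. card (accepted_words (next_state e x) n))"
    using finite_letters finite_accepted_words by (intro card_SigmaI) auto
  also have "\<dots> = (\<Sum>x\<in>letters. if step_ok e x then card (accepted_words (next_state e x) n) else 0)"
    using finite_letters by (rule sum.inter_filter)
  finally show ?thesis .
qed

definition support :: "('a \<Rightarrow> nat) \<Rightarrow> 'a set" where
  "support e = {v. e v \<noteq> 0}"

text \<open>After the letter \<open>(v, s)\<close> only \<open>v\<close> and those of its neighbours
  that were already in the support can carry nonzero exponents.\<close>

lemma clique_support_next_state:
  assumes "clique V E (support e)" "(v, s) \<in> letters"
  shows "clique V E (support (next_state e (v, s)))"
  using assms
  by (auto simp: clique_def support_def next_state_def letters_def insert_commute split: if_splits)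

end

section \<open>Matching finite sets by the sizes of fibres\<close>

lemma bij_betw_fibrewise:
  assumes "finite A" "finite B"
    and "\<And>y. card {a \<in> A. f a = y} = card {b \<in> B. g b = y}"
  obtains h where "bij_betw h A B" "\<And>a. a \<in> A \<Longrightarrow> g (h a) = f a"
proof -
  have "\<exists>h. bij_betw h {a \<in> A. f a = y} {b \<in> B. g b = y}" for y
    using assms by (intro finite_same_card_bij) auto
  then obtain h where h: "\<And>y. bij_betw (h y) {a \<in> A. f a = y} {b \<in> B. g b = y}"
    by metis
  \<comment> \<open>Fibres are disjoint, so the chosen bijections between them glue to one
    map.\<close>
  let ?h = "\<lambda>a. h (f a) a"
  have mem: "?h a \<in> B \<and> g (?h a) = f a" if "a \<in> A" for a
    using bij_betw_apply[OF h[of "f a"], of a] that by simp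
  have "inj_on ?h A"
  proof (rule inj_onI)
    fix a b assume ab: "a \<in> A" "b \<in> A" "?h a = ?h b"
    then have "f a = f b" using mem by metis
    then show "a = b"
      using bij_betw_imp_inj_on[OF h[of "f a"]] ab by (auto dest!: inj_onD)
  qed
  moreover have "B \<subseteq> ?h ` A"
  proof
    fix b assume "b \<in> B"
    then have "b \<in> h (g b) ` {a \<in> A. f a = g b}"
      using bij_betw_imp_surj_on[OF h[of "g b"]] by auto
    then obtain a where "a \<in> A" "b = ?h a" by auto
    then show "b \<in> ?h ` A" by blast
  qed
  ultimately have "bij_betw ?h A B"
    using mem by (auto simp: bij_betw_def)
  then show thesis using mem that by blast
qed

text \<open>Moebius inversion on the subsets of \<open>\<sigma>\<close>, by downward induction from
  \<open>\<sigma>\<close>: the count for supersets of \<open>\<tau>\<close> is the fibre over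
  \<open>\<tau>\<close> plus the fibres over its proper supersets, which agree by induction.\<close>

lemma card_fibre_eq_if_card_superset_eq:
  assumes "finite \<sigma>" "finite A" "finite B"
    and f: "\<And>a. a \<in> A \<Longrightarrow> f a \<subseteq> \<sigma>" and g: "\<And>b. b \<in> B \<Longrightarrow> g b \<subseteq> \<sigma>"
    and eq: "\<And>\<tau>. \<tau> \<subseteq> \<sigma> \<Longrightarrow> card {a \<in> A. \<tau> \<subseteq> f a} = card {b \<in> B. \<tau> \<subseteq> g b}"
    and "\<tau> \<subseteq> \<sigma>"
  shows "card {a \<in> A. f a = \<tau>} = card {b \<in> B. g b = \<tau>}"
  using \<open>\<tau> \<subseteq> \<sigma>\<close>
proof (induction "card (\<sigma> - \<tau>)" arbitrary: \<tau> rule: less_induct)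
  case less
  let ?R = "{\<rho>. \<tau> \<subset> \<rho> \<and> \<rho> \<subseteq> \<sigma>}"
  have finR: "finite ?R"
    using assms(1) by (auto intro: finite_subset[of _ "Pow \<sigma>"])
  have split: "card {c \<in> C. \<tau> \<subseteq> k c} = card {c \<in> C. k c = \<tau>} + (\<Sum>\<rho>\<in>?R. card {c \<in> C. k c = \<rho>})"
    if "finite C" "\<And>c. c \<in> C \<Longrightarrow> k c \<subseteq> \<sigma>" for C :: "'x set" and k
  proof -
    have "{c \<in> C. \<tau> \<subseteq> k c} = {c \<in> C. k c = \<tau>} \<union> (\<Union>\<rho>\<in>?R. {c \<in> C. k c = \<rho>})"
      using that(2) by auto
    also have "card \<dots> = card {c \<in> C. k c = \<tau>} + card (\<Union>\<rho>\<in>?R. {c \<in> C. k c = \<rho>})"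
      using that(1) finR by (intro card_Un_disjoint) auto
    also have "card (\<Union>\<rho>\<in>?R. {c \<in> C. k c = \<rho>}) = (\<Sum>\<rho>\<in>?R. card {c \<in> C. k c = \<rho>})"
      using that(1) finR by (intro card_UN_disjoint) auto
    finally show ?thesis .
  qed
  have "card {a \<in> A. f a = \<rho>} = card {b \<in> B. g b = \<rho>}" if "\<rho> \<in> ?R" for \<rho>
    using that assms(1) by (intro less.hyps psubset_card_mono) auto
  then have "(\<Sum>\<rho>\<in>?R. card {a \<in> A. f a = \<rho>}) = (\<Sum>\<rho>\<in>?R. card {b \<in> B. g b = \<rho>})"
    by (intro sum.cong) auto
  then show ?case
    using split[OF assms(2), of f] split[OF assms(3), of g] f g eq[OF less.prems] by simp
qed

section \<open>Links of subcliques and the matching of states\<close>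

lemma count_numbers:
  "finite U \<Longrightarrow> count (numbers N U) m = card {v \<in> U. N v = m}"
proof -
  assume "finite U"
  then have "count (numbers N U) m = (\<Sum>v\<in>N -` {m} \<inter> U. 1)"
    unfolding numbers_def count_image_mset by (intro sum.cong) auto
  also have "N -` {m} \<inter> U = {v \<in> U. N v = m}" by auto
  finally show ?thesis by simp
qed

lemma numbers_bij_betw:
  assumes "bij_betw \<phi> \<tau> \<tau>'" "\<And>v. v \<in> \<tau> \<Longrightarrow> N' (\<phi> v) = N v"
  shows "numbers N' \<tau>' = numbers N \<tau>"
proof (cases "finite \<tau>")
  case True
  have "mset_set \<tau>' = image_mset \<phi> (mset_set \<tau>)"
    using assms(1) by (simp add: bij_betw_def image_mset_mset_set)
  then show ?thesis
    using assms(2) True by (auto simp: numbers_def multiset.map_comp intro!: image_mset_cong)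
next
  case False
  then show ?thesis
    using bij_betw_finite[OF assms(1)] by (simp add: numbers_def)
qed

text \<open>The link of \<open>\<tau>\<close> consists of its common neighbours outside
  \<open>\<sigma>\<close> and, as \<open>\<sigma>\<close> is a clique, of all of
  \<open>\<sigma> - \<tau>\<close>. The difference is thus never truncated.\<close>

lemma card_common_neighbours:
  assumes "numbered_graph V E N" "clique V E \<sigma>" "\<tau> \<subseteq> \<sigma>"
  shows "card {v \<in> V - \<sigma>. N v = m \<and> (\<forall>u\<in>\<tau>. {u, v} \<in> E)}
    = count (numbers N (link V E \<tau>)) m - card {v \<in> \<sigma> - \<tau>. N v = m}"
proof -
  interpret numbered_graph V E N by (rule assms(1))
  have fin: "finite (link V E \<tau>)" "finite \<sigma>"
    using assms(2) finite_vertices finite_subset by (auto simp: link_def clique_def)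
  have "{v \<in> link V E \<tau>. N v = m}
      = {v \<in> V - \<sigma>. N v = m \<and> (\<forall>u\<in>\<tau>. {u, v} \<in> E)} \<union> {v \<in> \<sigma> - \<tau>. N v = m}"
    using assms(2,3) by (fastforce simp: link_def clique_def insert_commute)
  then have "count (numbers N (link V E \<tau>)) m
      = card {v \<in> V - \<sigma>. N v = m \<and> (\<forall>u\<in>\<tau>. {u, v} \<in> E)} + card {v \<in> \<sigma> - \<tau>. N v = m}"
    using fin finite_vertices by (subst count_numbers) (auto intro!: card_Un_disjoint)
  then show ?thesis by simp
qed

lemma clique_subset: "clique V E \<sigma> \<Longrightarrow> \<tau> \<subseteq> \<sigma> \<Longrightarrow> clique V E \<tau>"
  unfolding clique_def by blast

text \<open>\<open>\<psi>\<close> need not be a graph isomorphism: it respects adjacency only to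
  vertices of \<open>\<sigma>\<close>, which is all that one step of the automaton sees. Vertices
  outside \<open>\<sigma>\<close> are matched by order and by their neighbours in
  \<open>\<sigma>\<close>.\<close>

lemma extend_clique_bijection:
  assumes "numbered_graph V E N" "numbered_graph V' E' N'"
    and equiv: "equivalent_numbered_graphs V E N V' E' N'"
    and \<sigma>: "clique V E \<sigma>" and \<sigma>': "clique V' E' \<sigma>'"
    and \<phi>: "bij_betw \<phi> \<sigma> \<sigma>'" "\<And>v. v \<in> \<sigma> \<Longrightarrow> N' (\<phi> v) = N v"
  obtains \<psi> where "bij_betw \<psi> V V'" "\<And>v. v \<in> V \<Longrightarrow> N' (\<psi> v) = N v"
    "\<And>v. v \<in> \<sigma> \<Longrightarrow> \<psi> v = \<phi> v"
    "\<And>u v. u \<in> \<sigma> \<Longrightarrow> v \<in> V - \<sigma> \<Longrightarrow> {\<psi> u, \<psi> v} \<in> E' \<longleftrightarrow> {u, v} \<in> E"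
proof -
  have fin: "finite V" "finite V'"
    using assms(1,2) numbered_graph.finite_vertices by blast+
  have sub: "\<sigma> \<subseteq> V" "\<sigma>' \<subseteq> V'" using \<sigma> \<sigma>' by (auto simp: clique_def)
  define f where "f v = {u \<in> \<sigma>. {u, v} \<in> E}" for v
  \<comment> \<open>Neighbours in \<open>\<sigma>'\<close> are pulled back along
    \<open>\<phi>\<close>, so that \<open>f\<close> and \<open>g\<close> take values in subsets of
    the same clique and can be compared.\<close>
  define g where "g v = {u \<in> \<sigma>. {\<phi> u, v} \<in> E'}" for v
  have superset: "card {v \<in> V - \<sigma>. N v = m \<and> \<tau> \<subseteq> f v} = card {v \<in> V' - \<sigma>'. N' v = m \<and> \<tau> \<subseteq> g v}"
    if \<tau>: "\<tau> \<subseteq> \<sigma>" for \<tau> m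
  proof -
    have bij: "bij_betw \<phi> \<tau> (\<phi> ` \<tau>)" "bij_betw \<phi> (\<sigma> - \<tau>) (\<sigma>' - \<phi> ` \<tau>)"
    proof -
      show b: "bij_betw \<phi> \<tau> (\<phi> ` \<tau>)" using bij_betw_subset[OF \<phi>(1) \<tau>] by simp
      show "bij_betw \<phi> (\<sigma> - \<tau>) (\<sigma>' - \<phi> ` \<tau>)"
        using bij_betw_DiffI[OF \<phi>(1) b] \<tau> \<phi>(1) by (auto simp: bij_betw_def)
    qed
    have \<tau>': "\<phi> ` \<tau> \<subseteq> \<sigma>'" using \<tau> \<phi>(1) by (auto simp: bij_betw_def)
    have "numbers N \<tau> = numbers N' (\<phi> ` \<tau>)"
      by (rule numbers_bij_betw[OF bij(1), symmetric]) (use \<phi>(2) \<tau> in blast)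
    then have "numbers N (link V E \<tau>) = numbers N' (link V' E' (\<phi> ` \<tau>))"
      using equiv clique_subset[OF \<sigma> \<tau>] clique_subset[OF \<sigma>' \<tau>']
      by (auto simp: equivalent_numbered_graphs_def)
    moreover have "card {v \<in> \<sigma> - \<tau>. N v = m} = card {v \<in> \<sigma>' - \<phi> ` \<tau>. N' v = m}"
    proof -
      have "numbers N' (\<sigma>' - \<phi> ` \<tau>) = numbers N (\<sigma> - \<tau>)"
        using bij(2) \<phi>(2) by (intro numbers_bij_betw) auto
      then show ?thesis
        using fin sub finite_subset by (metis count_numbers finite_Diff)
    qed
    ultimately have "card {v \<in> V - \<sigma>. N v = m \<and> (\<forall>u\<in>\<tau>. {u, v} \<in> E)}
        = card {v \<in> V' - \<sigma>'. N' v = m \<and> (\<forall>u\<in>\<phi> ` \<tau>. {u, v} \<in> E')}"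
      using card_common_neighbours[OF assms(1) \<sigma> \<tau>] card_common_neighbours[OF assms(2) \<sigma>' \<tau>']
      by metis
    moreover have "\<tau> \<subseteq> f v \<longleftrightarrow> (\<forall>u\<in>\<tau>. {u, v} \<in> E)" for v
      using \<tau> by (auto simp: f_def)
    moreover have "\<tau> \<subseteq> g v \<longleftrightarrow> (\<forall>u\<in>\<phi> ` \<tau>. {u, v} \<in> E')" for v
      using \<tau> by (auto simp: g_def)
    ultimately show ?thesis by simp
  qed
  have "card {v \<in> V - \<sigma>. (N v, f v) = y} = card {v \<in> V' - \<sigma>'. (N' v, g v) = y}" for y
  proof (cases y)
    case (Pair m \<tau>)
    show ?thesis
    proof (cases "\<tau> \<subseteq> \<sigma>")
      case True
      have "card {v \<in> {v \<in> V - \<sigma>. N v = m}. f v = \<tau>} = card {v \<in> {v \<in> V' - \<sigma>'. N' v = m}. g v = \<tau>}"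
      proof (rule card_fibre_eq_if_card_superset_eq[where \<sigma> = \<sigma>])
        show "card {v \<in> {v \<in> V - \<sigma>. N v = m}. \<tau> \<subseteq> f v}
            = card {v \<in> {v \<in> V' - \<sigma>'. N' v = m}. \<tau> \<subseteq> g v}" if "\<tau> \<subseteq> \<sigma>" for \<tau>
          using superset[OF that] by (simp add: conj_assoc)
      qed (use True fin sub finite_subset in \<open>auto simp: f_def g_def\<close>)
      then show ?thesis by (simp add: Pair conj_assoc)
    next
      case False
      then have "{v \<in> V - \<sigma>. (N v, f v) = y} = {}" "{v \<in> V' - \<sigma>'. (N' v, g v) = y} = {}"
        by (auto simp: Pair f_def g_def)
      then show ?thesis by (simp only: card.empty)
    qed
  qed
  then obtain h where h: "bij_betw h (V - \<sigma>) (V' - \<sigma>')"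
      "\<And>v. v \<in> V - \<sigma> \<Longrightarrow> (N' (h v), g (h v)) = (N v, f v)"
    using bij_betw_fibrewise[of "V - \<sigma>" "V' - \<sigma>'" "\<lambda>v. (N v, f v)" "\<lambda>v. (N' v, g v)"] fin
    by blast
  define \<psi> where "\<psi> v = (if v \<in> \<sigma> then \<phi> v else h v)" for v
  have "bij_betw \<psi> \<sigma> \<sigma>'" "bij_betw \<psi> (V - \<sigma>) (V' - \<sigma>')"
    using \<phi>(1) h(1) bij_betw_cong[of \<sigma> \<psi> \<phi> \<sigma>'] bij_betw_cong[of "V - \<sigma>" \<psi> h "V' - \<sigma>'"]
    by (simp_all add: \<psi>_def)
  then have "bij_betw \<psi> (\<sigma> \<union> (V - \<sigma>)) (\<sigma>' \<union> (V' - \<sigma>'))"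
    by (rule bij_betw_combine) auto
  moreover have "\<sigma> \<union> (V - \<sigma>) = V" "\<sigma>' \<union> (V' - \<sigma>') = V'" using sub by auto
  ultimately have "bij_betw \<psi> V V'" by simp
  moreover have "{\<psi> u, \<psi> v} \<in> E' \<longleftrightarrow> {u, v} \<in> E" if "u \<in> \<sigma>" "v \<in> V - \<sigma>" for u v
  proof -
    have "u \<in> g (h v) \<longleftrightarrow> u \<in> f v" using h(2)[OF that(2)] by simp
    then show ?thesis using that by (simp add: f_def g_def \<psi>_def)
  qed
  ultimately show thesis
    using that[of \<psi>] \<phi>(2) h(2) by (auto simp: \<psi>_def)
qed

text \<open>Induction on the word length for all matched pairs of states: no single bijection serves
  for a whole word, so each step extends the current \<open>\<phi>\<close> to a new
  \<open>\<psi>\<close>, whose restriction matches the next states.\<close>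

lemma card_accepted_words_equivalent:
  assumes g: "numbered_graph V E N" "numbered_graph V' E' N'"
    and equiv: "equivalent_numbered_graphs V E N V' E' N'"
    and "clique V E (numbered_graph.support e)" "clique V' E' (numbered_graph.support e')"
    and "bij_betw \<phi> (numbered_graph.support e) (numbered_graph.support e')"
    and "\<And>v. v \<in> numbered_graph.support e \<Longrightarrow> N' (\<phi> v) = N v \<and> e' (\<phi> v) = e v"
  shows "card (numbered_graph.accepted_words V E N e n)
    = card (numbered_graph.accepted_words V' E' N' e' n)"
  using assms(4-)
proof (induction n arbitrary: e e' \<phi>)
  case 0
  interpret A: numbered_graph V E N by (rule g)
  interpret B: numbered_graph V' E' N' by (rule g)
  have "A.accepted_words e 0 = {[]}" "B.accepted_words e' 0 = {[]}"
    by (auto simp: A.accepted_words_def B.accepted_words_def)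
  then show ?case by simp
next
  case (Suc n)
  interpret A: numbered_graph V E N by (rule g)
  interpret B: numbered_graph V' E' N' by (rule g)
  obtain \<psi> where \<psi>: "bij_betw \<psi> V V'" "\<And>v. v \<in> V \<Longrightarrow> N' (\<psi> v) = N v"
    "\<And>v. v \<in> A.support e \<Longrightarrow> \<psi> v = \<phi> v"
    "\<And>u v. u \<in> A.support e \<Longrightarrow> v \<in> V - A.support e \<Longrightarrow> {\<psi> u, \<psi> v} \<in> E' \<longleftrightarrow> {u, v} \<in> E"
    using extend_clique_bijection[OF g equiv Suc.prems(1-3), of thesis] Suc.prems(4) by blast
  have inj: "\<psi> u = \<psi> v \<longleftrightarrow> u = v" if "u \<in> V" "v \<in> V" for u v
    using \<psi>(1) that by (auto simp: bij_betw_def inj_on_def)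
  have supp: "A.support e \<subseteq> V" "B.support e' \<subseteq> V'"
    using Suc.prems by (auto simp: clique_def)
  have surj: "\<psi> ` V = V'" using \<psi>(1) by (simp add: bij_betw_def)
  \<comment> \<open>Outside the supports both exponents are 0: \<open>\<phi>\<close> is onto the
    support of \<open>e'\<close> and \<open>\<psi>\<close> is injective, so \<open>\<psi>\<close>
    maps no further vertex into it.\<close>
  have e: "e' (\<psi> v) = e v" if "v \<in> V" for v
  proof (cases "v \<in> A.support e")
    case True
    then show ?thesis using Suc.prems(4) \<psi>(3) by simp
  next
    case False
    have "\<psi> v \<notin> B.support e'"
    proof
      assume "\<psi> v \<in> B.support e'"
      then obtain u where u: "u \<in> A.support e" "\<psi> v = \<phi> u"
        using Suc.prems(3) by (auto simp: bij_betw_def)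
      then have "\<psi> v = \<psi> u" using \<psi>(3) by simp
      then show False using inj u that supp False by blast
    qed
    then show ?thesis using False by (simp add: A.support_def B.support_def)
  qed
  have edge: "{\<psi> u, \<psi> v} \<in> E' \<longleftrightarrow> {u, v} \<in> E" if "u \<in> A.support e" "v \<in> V" "u \<noteq> v" for u v
  proof (cases "v \<in> A.support e")
    case True
    then have "{u, v} \<in> E" using that Suc.prems(1) by (auto simp: clique_def)
    moreover have "{\<psi> u, \<psi> v} \<in> E'"
    proof -
      have "\<psi> u \<in> B.support e'" "\<psi> v \<in> B.support e'"
        using True that e supp by (auto simp: A.support_def B.support_def)
      moreover have "\<psi> u \<noteq> \<psi> v" using inj that supp by blast
      ultimately show ?thesis using Suc.prems(2) by (auto simp: clique_def)
    qed
    ultimately show ?thesis by simp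
  next
    case False
    then show ?thesis using \<psi>(4) that by simp
  qed
  let ?l = "\<lambda>(v, s). (\<psi> v, s :: nat)"
  have bij: "bij_betw ?l A.letters B.letters"
  proof (rule bij_betw_imageI)
    show "inj_on ?l A.letters"
      using inj by (auto simp: inj_on_def A.letters_def)
    show "?l ` A.letters = B.letters"
    proof
      show "?l ` A.letters \<subseteq> B.letters"
        using surj \<psi>(2) by (auto simp: A.letters_def B.letters_def)
      show "B.letters \<subseteq> ?l ` A.letters"
      proof
        fix y assume y: "y \<in> B.letters"
        obtain v' s where vs: "y = (v', s)" by force
        then obtain v where "v \<in> V" "v' = \<psi> v"
          using y surj by (auto simp: B.letters_def)
        then show "y \<in> ?l ` A.letters"
          using y vs \<psi>(2) by (intro image_eqI[of _ _ "(v, s)"]) (auto simp: A.letters_def B.letters_def)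
      qed
    qed
  qed
  have "(if A.step_ok e x then card (A.accepted_words (A.next_state e x) n) else 0)
    = (if B.step_ok e' (?l x) then card (B.accepted_words (B.next_state e' (?l x)) n) else 0)"
    if x: "x \<in> A.letters" for x
  proof -
    obtain v s where vs: "x = (v, s)" by force
    then have v: "v \<in> V" using x by (auto simp: A.letters_def)
    have y: "(\<psi> v, s) \<in> B.letters"
      using bij_betw_apply[OF bij x] vs by simp
    let ?d = "A.next_state e (v, s)" and ?d' = "B.next_state e' (\<psi> v, s)"
    \<comment> \<open>For \<open>u\<close> other than \<open>v\<close>, adjacency to
      \<open>v\<close> matters only if \<open>e u\<close> is nonzero, and then \<open>u\<close> lies
      in the support, where \<open>edge\<close> applies.\<close>
    have d: "?d' (\<psi> u) = ?d u" if "u \<in> V" for u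
    proof (cases "u = v")
      case True
      then show ?thesis using v \<psi>(2) e by (simp add: A.next_state_def B.next_state_def)
    next
      case False
      then show ?thesis
        using edge[of u v] that v inj[OF that v] e[OF that]
        by (cases "e u = 0") (auto simp: A.next_state_def B.next_state_def A.support_def)
    qed
    have c: "clique V E (A.support ?d)" "clique V' E' (B.support ?d')"
      using A.clique_support_next_state B.clique_support_next_state Suc.prems(1,2) x y vs by auto
    have sub: "A.support ?d \<subseteq> V" "B.support ?d' \<subseteq> V'"
      using c by (auto simp: clique_def)
    have "\<psi> ` A.support ?d = B.support ?d'"
      using sub d surj by (fastforce simp: A.support_def B.support_def)
    then have "bij_betw \<psi> (A.support ?d) (B.support ?d')"
      using bij_betw_subset[OF \<psi>(1) sub(1)] by simp
    then have "card (A.accepted_words ?d n) = card (B.accepted_words ?d' n)"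
      using c sub d \<psi>(2) by (intro Suc.IH) auto
    moreover have "A.step_ok e x \<longleftrightarrow> B.step_ok e' (\<psi> v, s)"
      using vs v \<psi>(2) e by (simp add: A.step_ok_def B.step_ok_def A.exp_length_def B.exp_length_def)
    ultimately show ?thesis by (simp add: vs)
  qed
  then show ?case
    unfolding A.card_accepted_words_Suc B.card_accepted_words_Suc
    by (subst sum.reindex_bij_betw[OF bij, symmetric]) (intro sum.cong, auto)
qed

theorem theorem5p14:
  fixes V :: "'a set" and E :: "'a set set" and N :: "'a \<Rightarrow> nat"
    and V' :: "'b set" and E' :: "'b set set" and N' :: "'b \<Rightarrow> nat"
  assumes "numbered_graph V E N" and "numbered_graph V' E' N'"
    and "link_regular V E N" and "link_regular V' E' N'"
    and "equivalent_numbered_graphs V E N V' E' N'"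
  shows "geodesic_growth_series (NGP V E N) (NGP_standard_gens V E N) =
         geodesic_growth_series (NGP V' E' N') (NGP_standard_gens V' E' N')"
proof -
  interpret A: numbered_graph V E N by (rule assms(1))
  interpret B: numbered_graph V' E' N' by (rule assms(2))
  \<comment> \<open>Both automata start with empty support, a clique in either graph, so the states
    match trivially.\<close>
  have "card (A.accepted_words (\<lambda>_. 0) n) = card (B.accepted_words (\<lambda>_. 0) n)" for n
    by (rule card_accepted_words_equivalent[OF assms(1,2,5)])
      (auto simp: A.support_def B.support_def clique_def bij_betw_def)
  then show ?thesis
    by (simp add: geodesic_growth_series_def A.card_geodesic_words B.card_geodesic_words)
qed

end
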